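(* Let $x\in\mathbb{R}$ and consider the equation $\frac{z^3+z^2}{2}=x$ in the real unknown $z$. 1. If $x>\frac{2}{27}$, there is a unique real solution, namely $z_1=MY(x)$. 2. If $x<0$, there is a unique real solution, namely $z_1=-\frac23-MY\left(\frac{2}{27}-x\right)$. 3. If $0\le x\le\frac{2}{27}$, there are three real solutions (counted with multiplicity), namely $$z_1=MY(x),\qquad z_2=-\frac23-MY\left(\frac{2}{27}-x\right),\qquad z_3=MY\left(\frac{2}{27}-x\right)-MY(x)-\frac13,$$ and they satisfy $z_2\le z_3\le z_1$.
   Context: The function $MY:[0,+\infty)\to[0,+\infty)$ is the inverse of the strictly increasing continuous bijection $[0,+\infty)\to[0,+\infty)$, $z\mapsto \frac{z^3+z^2}{2}$; that is, for $x\ge 0$, $MY(x)$ is the unique real $z\ge 0$ with $\frac{z^3+z^2}{2}=x$. *)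

theory Defs
  imports "HOL-Analysis.Analysis"
begin

definition cubic :: "real \<Rightarrow> real" where
  "cubic z = (z ^ 3 + z ^ 2) / 2"

(* Only the values at x >= 0 are meaningful; below 0 the_inv_into is unspecified. *)
definition MY :: "real \<Rightarrow> real" where
  "MY = the_inv_into {0..} cubic"

lemma strict_mono_on_cubic: "strict_mono_on {0..} cubic"
proof (rule strict_mono_onI)
  fix a b :: real assume "a \<in> {0..}" "b \<in> {0..}" "a < b"
  then have "a ^ 3 < b ^ 3" "a ^ 2 < b ^ 2"
    by (auto intro: power_strict_mono)
  then show "cubic a < cubic b" by (simp add: cubic_def)
qed

lemma continuous_on_cubic: "continuous_on S cubic"
  unfolding cubic_def by (intro continuous_intros) auto

lemma bij_betw_cubic: "bij_betw cubic {0..} {0..}"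
proof (rule bij_betw_imageI)
  show "inj_on cubic {0..}"
    using strict_mono_on_cubic by (rule strict_mono_on_imp_inj_on)
  show "cubic ` {0..} = {0..}"
  proof (intro equalityI subsetI)
    fix y assume "y \<in> cubic ` {0..}"
    then show "y \<in> {0..}" by (auto simp: cubic_def)
  next
    fix y :: real assume "y \<in> {0..}"
    then have y: "0 \<le> y" by simp
    have "0 \<le> y ^ 2" "0 \<le> y ^ 3" using y by auto
    then have "y \<le> cubic (1 + y)" using y
      by (simp add: cubic_def power3_eq_cube power2_eq_square algebra_simps)
    then have "\<exists>z. 0 \<le> z \<and> z \<le> 1 + y \<and> cubic z = y"
      using y by (intro IVT' continuous_on_cubic) (auto simp: cubic_def)
    then show "y \<in> cubic ` {0..}" by auto
  qed
qed

lemma MY_eq_iff: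
  assumes "0 \<le> x"
  shows "MY x = z \<longleftrightarrow> 0 \<le> z \<and> (z ^ 3 + z ^ 2) / 2 = x"
  using assms bij_betw_cubic
  by (metis MY_def atLeast_iff bij_betw_def cubic_def f_the_inv_into_f_bij_betw
      the_inv_into_f_f the_inv_into_into order_refl)

(* The polynomial whose roots, counted with multiplicity, are the solutions of
   cubic z = x. *)
definition cubic_poly :: "real \<Rightarrow> real poly" where
  "cubic_poly x = [:- x, 0, 1/2, 1/2:]"

lemma poly_cubic_poly: "poly (cubic_poly x) z = (z ^ 3 + z ^ 2) / 2 - x"
  by (simp add: cubic_poly_def power3_eq_cube power2_eq_square field_simps)

end

(* The graph of the cubic is symmetric about its inflection point (-1/3, 1/27), which exchanges
   x with 2/27 - x and z with -2/3 - z.  Above the local maximum value 2/27 every solution is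
   nonnegative, hence is MY x; the case x < 0 is the mirror image.  In between, MY x and the mirror
   image of MY (2/27 - x) are distinct roots, and Vieta's formula for the sum of the roots, -1,
   gives the third. *)

theory Submission
  imports Defs
begin

lemma cubic_reflect: "cubic (- 2 / 3 - z) = 2 / 27 - cubic z"
  by (simp add: cubic_def power3_eq_cube power2_eq_square field_simps)

lemma cubic_MY: "0 \<le> x \<Longrightarrow> cubic (MY x) = x"
  and MY_nonneg: "0 \<le> x \<Longrightarrow> 0 \<le> MY x"
  using MY_eq_iff[of x "MY x"] by (auto simp: cubic_def)

text \<open>Monotonicity on the nonnegative reals, with \<open>cubic (1 / 3) = 2 / 27\<close>. The
  bound is what later orders the three roots.\<close>

lemma MY_le_one_third:
  assumes "0 \<le> x" "x \<le> 2 / 27"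
  shows "MY x \<le> 1 / 3"
proof (rule ccontr)
  assume "\<not> MY x \<le> 1 / 3"
  then have "cubic (1 / 3) < cubic (MY x)"
    using strict_mono_on_cubic by (auto simp: strict_mono_on_def)
  then show False
    using assms by (simp add: cubic_MY) (simp add: cubic_def power3_eq_cube power2_eq_square)
qed

lemma cubic_le_of_le_one_third:
  assumes "z \<le> 1 / 3"
  shows "cubic z \<le> 2 / 27"
proof -
  \<comment> \<open>The local maximum at -2/3 makes it a double root of the difference; 1/3 is the
    remaining simple root.\<close>
  have "cubic z - 2 / 27 = (z + 2 / 3)\<^sup>2 * (z - 1 / 3) / 2"
    by (simp add: cubic_def power3_eq_cube power2_eq_square field_simps)
  also have "\<dots> \<le> 0"
    using assms by (simp add: mult_nonneg_nonpos)
  finally show ?thesis by simp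
qed

lemma cubic_eq_iff_MY:
  assumes "2 / 27 < x"
  shows "cubic z = x \<longleftrightarrow> z = MY x"
proof
  assume "cubic z = x"
  moreover from this have "0 \<le> z"
    using cubic_le_of_le_one_third[of z] assms by linarith
  ultimately show "z = MY x"
    using MY_eq_iff[of x z] assms by (simp add: cubic_def)
qed (use assms in \<open>simp add: cubic_MY\<close>)

lemma cubic_eq_iff_reflected_MY:
  assumes "x < 0"
  shows "cubic z = x \<longleftrightarrow> z = - 2 / 3 - MY (2 / 27 - x)"
proof -
  have "cubic z = x \<longleftrightarrow> cubic (- 2 / 3 - z) = 2 / 27 - x"
    unfolding cubic_reflect by linarith
  also have "\<dots> \<longleftrightarrow> - 2 / 3 - z = MY (2 / 27 - x)"
    using assms by (intro cubic_eq_iff_MY) simp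
  finally show ?thesis by linarith
qed

lemma cubic_poly_eq_of_two_roots:
  assumes "cubic a = x" "cubic b = x" "a \<noteq> b"
  shows "cubic_poly x = smult (1 / 2) ([:- a, 1:] * [:- b, 1:] * [:- (- 1 - a - b), 1:])"
proof -
  \<comment> \<open>Cancelling \<open>a - b\<close> leaves \<open>quot\<close>, which says that the
    linear coefficient of the factored form vanishes.\<close>
  have "(a - b) * (a * a + a * b + b * b + a + b) = 2 * (cubic a - cubic b)"
    by (simp add: cubic_def power3_eq_cube power2_eq_square field_simps)
  then have quot: "a * a + a * b + b * b + a + b = 0"
    using assms by simp
  \<comment> \<open>Constant coefficient: \<open>2 * x\<close> must be the product of the three
    roots.\<close>
  have "2 * x = a * (a * a + a)"
    using assms(1) by (simp add: cubic_def power3_eq_cube power2_eq_square field_simps)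
  also have "a * a + a = - (b * (a + b + 1))"
    using quot by (simp add: algebra_simps)
  finally show ?thesis
    using quot by (simp add: cubic_poly_def algebra_simps)
qed

lemma proots_cubic_poly_of_two_roots:
  assumes "cubic a = x" "cubic b = x" "a \<noteq> b"
  shows "proots (cubic_poly x) = {#a, b, - 1 - a - b#}"
  unfolding cubic_poly_eq_of_two_roots[OF assms]
  \<comment> \<open>The deleted rules would multiply the linear factors out before
    \<open>proots_mult\<close> could split them.\<close>
  by (simp add: proots_mult del: mult_pCons_left mult_pCons_right)

text \<open>Lets the solution set be read off the multiset of roots; nonzeroness matters because
  \<open>proots\<close> of the zero polynomial is empty.\<close>

lemma cubic_eq_iff_mem_proots: "cubic z = x \<longleftrightarrow> z \<in># proots (cubic_poly x)"
proof -
  have "cubic_poly x \<noteq> 0"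
    by (simp add: cubic_poly_def)
  then show ?thesis
    by (simp add: poly_cubic_poly cubic_def)
qed

theorem mainTheorem2:
  fixes x :: real
  shows "(x > 2 / 27 \<longrightarrow> {z :: real. (z ^ 3 + z ^ 2) / 2 = x} = {MY x}) \<and>
    (x < 0 \<longrightarrow> {z :: real. (z ^ 3 + z ^ 2) / 2 = x} = {- 2 / 3 - MY (2 / 27 - x)}) \<and>
    (0 \<le> x \<and> x \<le> 2 / 27 \<longrightarrow>
      (let z1 = MY x;
           z2 = - 2 / 3 - MY (2 / 27 - x);
           z3 = MY (2 / 27 - x) - MY x - 1 / 3
       in {z :: real. (z ^ 3 + z ^ 2) / 2 = x} = {z1, z2, z3} \<and>
          proots (cubic_poly x) = {#z1, z2, z3#} \<and>
          z2 \<le> z3 \<and> z3 \<le> z1))"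
proof (intro conjI impI)
  assume "x > 2 / 27"
  then show "{z. (z ^ 3 + z ^ 2) / 2 = x} = {MY x}"
    by (simp add: cubic_eq_iff_MY flip: cubic_def)
next
  assume "x < 0"
  then show "{z. (z ^ 3 + z ^ 2) / 2 = x} = {- 2 / 3 - MY (2 / 27 - x)}"
    by (simp add: cubic_eq_iff_reflected_MY flip: cubic_def)
next
  assume x: "0 \<le> x \<and> x \<le> 2 / 27"
  define a b where "a = MY x" and "b = MY (2 / 27 - x)"
  have a: "0 \<le> a" "a \<le> 1 / 3" "cubic a = x"
    using x MY_le_one_third[of x] by (auto simp: a_def MY_nonneg cubic_MY)
  have b: "0 \<le> b" "b \<le> 1 / 3" "cubic (- 2 / 3 - b) = x"
    unfolding cubic_reflect using x MY_le_one_third[of "2 / 27 - x"]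
    by (auto simp: b_def MY_nonneg cubic_MY)
  \<comment> \<open>The two have opposite signs, even at x = 0 and x = 2/27, where the third root
    coincides with one of them.\<close>
  have "a \<noteq> - 2 / 3 - b"
    using a b by linarith
  from proots_cubic_poly_of_two_roots[OF a(3) b(3) this]
  have roots: "proots (cubic_poly x) = {#a, - 2 / 3 - b, b - a - 1 / 3#}"
    by (simp add: algebra_simps)
  have "{z. (z ^ 3 + z ^ 2) / 2 = x} = {a, - 2 / 3 - b, b - a - 1 / 3}"
    unfolding cubic_def[symmetric] cubic_eq_iff_mem_proots roots by auto
  \<comment> \<open>The ordering amounts to \<open>a\<close> \<le> 1/3 + 2 \<open>b\<close> and
    \<open>b\<close> \<le> 1/3 + 2 \<open>a\<close>.\<close>
  with roots a b show "let z1 = MY x; z2 = - 2 / 3 - MY (2 / 27 - x);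
      z3 = MY (2 / 27 - x) - MY x - 1 / 3
    in {z. (z ^ 3 + z ^ 2) / 2 = x} = {z1, z2, z3} \<and>
      proots (cubic_poly x) = {#z1, z2, z3#} \<and> z2 \<le> z3 \<and> z3 \<le> z1"
    unfolding Let_def a_def[symmetric] b_def[symmetric] by (intro conjI) linarith+
qed

end
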